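(* Let $G$ be a connected graph, $r$ a vertex of $G$, $t\ge 1$, and $E_r$ a set of edges of $G$ each joining two neighbors of $r$. Suppose $G-r-E_r$ has connected components $G_1,\dots,G_j$ with $j>1$, and let $G'_i$ be the subgraph of $G$ induced by $V(G_i)\cup\{r\}$. Then \[\pi_t(G,r)=\max\Big\{\sum_{i=1}^j \pi_{t_i}(G'_i,r)-j+1\ :\ t_1,\dots,t_j \text{ positive integers},\ \sum_{i=1}^j t_i=t+j-1\Big\}.\]
   Context: A configuration on a graph $H$ is $C:V(H)\to\mathbb{N}$ with size $\sum_vC(v)$; a pebbling step from a vertex with at least two pebbles to a neighbor removes two pebbles there and adds one to the neighbor. $C$ is $t$-fold $r$-solvable if some sequence of pebbling steps places at least $t$ pebbles on $r$; $\pi_t(H,r)$ is the least $m$ such that every configuration of size $m$ on $H$ is $t$-fold $r$-solvable. *)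

theory Defs
  imports "Graph_Theory.Digraph_Component"
begin

text \<open>
  Finite simple graphs are symmetric loop-free digraphs without parallel arcs (locale
  \<open>graph\<close>). An undirected edge is the set \<open>{u, v}\<close> of its endpoints, so each edge
  corresponds to two mutually reverse arcs, and deleting it deletes both.
\<close>

definition edges :: "('a, 'b) pre_digraph \<Rightarrow> 'a set set" where
  "edges G = {{tail G a, head G a} | a. a \<in> arcs G}"

definition del_edges :: "('a, 'b) pre_digraph \<Rightarrow> 'a set set \<Rightarrow> ('a, 'b) pre_digraph" where
  "del_edges G F = G\<lparr>arcs := {a \<in> arcs G. {tail G a, head G a} \<notin> F}\<rparr>"

definition components :: "('a, 'b) pre_digraph \<Rightarrow> ('a, 'b) pre_digraph set" where
  "components G = {H. pre_digraph.max_subgraph G Digraph_Component.connected H}"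

text \<open>
  A configuration is a total function; its values outside \<open>verts G\<close> do not contribute to the
  size and are never touched by a pebbling step.
\<close>

definition config_size :: "('a, 'b) pre_digraph \<Rightarrow> ('a \<Rightarrow> nat) \<Rightarrow> nat" where
  "config_size G C = (\<Sum>v\<in>verts G. C v)"

definition pebbling_step :: "('a, 'b) pre_digraph \<Rightarrow> ('a \<Rightarrow> nat) \<Rightarrow> ('a \<Rightarrow> nat) \<Rightarrow> bool" where
  "pebbling_step G C D \<longleftrightarrow>
     (\<exists>u v. u \<rightarrow>\<^bsub>G\<^esub> v \<and> 2 \<le> C u \<and> D = C(u := C u - 2, v := C v + 1))"

definition fold_solvable :: "('a, 'b) pre_digraph \<Rightarrow> 'a \<Rightarrow> nat \<Rightarrow> ('a \<Rightarrow> nat) \<Rightarrow> bool" where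
  "fold_solvable G r t C \<longleftrightarrow> (\<exists>D. (pebbling_step G)\<^sup>*\<^sup>* C D \<and> t \<le> D r)"

definition pebbling_number :: "nat \<Rightarrow> ('a, 'b) pre_digraph \<Rightarrow> 'a \<Rightarrow> nat" where
  "pebbling_number t G r = (LEAST m. \<forall>C. config_size G C = m \<longrightarrow> fold_solvable G r t C)"

end

theory Submission
  imports Defs
begin

text \<open>
  If each \<open>G\<^sub>i'\<close> carries a largest configuration that is not \<open>t\<^sub>i\<close>-fold solvable,
  their union on \<open>G\<close> is not \<open>t\<close>-fold solvable: moving pebbles out of \<open>r\<close>, or along an edge of \<open>E\<^sub>r\<close>
  into another part, gains nothing over leaving them at \<open>r\<close>, respectively moving them directly to \<open>r\<close>,
  so at most \<open>\<Sum>\<^sub>i (t\<^sub>i - 1) = t - 1\<close> pebbles reach the root. Conversely, if a configuration on \<open>G\<close>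
  is not \<open>t\<close>-fold solvable, let \<open>s\<^sub>i\<close> be the largest number of pebbles that its restriction to \<open>G\<^sub>i'\<close>
  can bring to \<open>r\<close> (with the pebbles of \<open>r\<close> assigned to a single part). Playing
  in all parts simultaneously shows \<open>\<Sum>\<^sub>i s\<^sub>i \<le> t - 1\<close>; so \<open>t\<^sub>i = s\<^sub>i + 1\<close>, with the slack added to one
  of them, is an admissible choice for which every restriction is not \<open>t\<^sub>i\<close>-fold solvable.
\<close>

section \<open>Pebbling steps\<close>

lemma pebbling_step_mono:
  assumes "arcs_ends H \<subseteq> arcs_ends G" "pebbling_step H C D"
  shows "pebbling_step G C D"
  using assms unfolding pebbling_step_def by blast

lemma pebbling_steps_mono:
  assumes "arcs_ends H \<subseteq> arcs_ends G" "(pebbling_step H)\<^sup>*\<^sup>* C D"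
  shows "(pebbling_step G)\<^sup>*\<^sup>* C D"
  using assms(2) by (rule rtranclp_mono[THEN predicate2D, rotated])
    (auto intro: pebbling_step_mono[OF assms(1)])

lemma pebbling_step_add:
  assumes "pebbling_step G C D"
  shows "pebbling_step G (\<lambda>v. C v + E v) (\<lambda>v. D v + E v)"
proof -
  obtain u v where "u \<rightarrow>\<^bsub>G\<^esub> v" "2 \<le> C u" "D = C(u := C u - 2, v := C v + 1)"
    using assms unfolding pebbling_step_def by blast
  then show ?thesis
    unfolding pebbling_step_def by (intro exI[of _ u] exI[of _ v]) (auto simp: fun_eq_iff)
qed

lemma pebbling_steps_add:
  assumes "(pebbling_step G)\<^sup>*\<^sup>* C D"
  shows "(pebbling_step G)\<^sup>*\<^sup>* (\<lambda>v. C v + E v) (\<lambda>v. D v + E v)"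
  using assms
  by induction (auto intro: rtranclp.rtrancl_into_rtrancl pebbling_step_add)

text \<open>Superposed configurations can be played one after another while the pebbles of the other
  summands lie idle. This is what allows all parts to be played together on
  \<open>G\<close>.\<close>

lemma pebbling_steps_sum:
  assumes "finite I" "\<And>i. i \<in> I \<Longrightarrow> (pebbling_step G)\<^sup>*\<^sup>* (C i) (D i)"
  shows "(pebbling_step G)\<^sup>*\<^sup>* (\<lambda>v. \<Sum>i\<in>I. C i v) (\<lambda>v. \<Sum>i\<in>I. D i v)"
  using assms
proof (induction I)
  case empty
  then show ?case by simp
next
  case (insert x I)
  have "(pebbling_step G)\<^sup>*\<^sup>* (\<lambda>v. C x v + (\<Sum>i\<in>I. C i v)) (\<lambda>v. D x v + (\<Sum>i\<in>I. C i v))"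
    using insert.prems by (intro pebbling_steps_add) auto
  also have "(pebbling_step G)\<^sup>*\<^sup>* (\<lambda>v. D x v + (\<Sum>i\<in>I. C i v)) (\<lambda>v. D x v + (\<Sum>i\<in>I. D i v))"
    using pebbling_steps_add[OF insert.IH, of "D x"] insert.prems by (simp add: add.commute)
  finally show ?case using insert.hyps by simp
qed

lemma fold_solvable_mono:
  assumes "fold_solvable G r t C" "\<And>v. C v \<le> C' v"
  shows "fold_solvable G r t C'"
proof -
  obtain D where D: "(pebbling_step G)\<^sup>*\<^sup>* C D" "t \<le> D r"
    using assms(1) unfolding fold_solvable_def by blast
  have "(\<lambda>v. C v + (C' v - C v)) = C'"
    using assms(2) by (simp add: fun_eq_iff)
  then show ?thesis
    unfolding fold_solvable_def
    using pebbling_steps_add[OF D(1), of "\<lambda>v. C' v - C v"] D(2)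
    by (intro exI[of _ "\<lambda>v. D v + (C' v - C v)"]) auto
qed

lemma repeated_pebbling_step:
  assumes "u \<rightarrow>\<^bsub>G\<^esub> v" "u \<noteq> v" "2 * k \<le> C u"
  shows "(pebbling_step G)\<^sup>*\<^sup>* C (C(u := C u - 2 * k, v := C v + k))"
  using assms(3)
proof (induction k)
  case 0
  then show ?case by simp
next
  case (Suc k)
  let ?D = "C(u := C u - 2 * k, v := C v + k)"
  have "pebbling_step G ?D (C(u := C u - 2 * Suc k, v := C v + Suc k))"
    unfolding pebbling_step_def using assms(1,2) Suc.prems
    by (intro exI[of _ u] exI[of _ v]) (auto simp: fun_eq_iff)
  with Suc.IH Suc.prems show ?case
    by (meson Suc_leD mult_le_mono2 order.refl order.trans le_SucI rtranclp.rtrancl_into_rtrancl)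
qed

text \<open>\<open>pebbling_number\<close> speaks only of configurations of one exact size; trimming
  a larger configuration to that size extends solvability to all larger sizes.\<close>

lemma ex_subconfig_of_size:
  fixes C :: "'a \<Rightarrow> nat"
  assumes "finite S" "m \<le> (\<Sum>v\<in>S. C v)"
  shows "\<exists>C'. (\<forall>v. C' v \<le> C v) \<and> (\<Sum>v\<in>S. C' v) = m"
  using assms(2)
proof (induction m)
  case 0
  then show ?case by (intro exI[of _ "\<lambda>_. 0"]) auto
next
  case (Suc m)
  then obtain C' where C': "\<forall>v. C' v \<le> C v" "(\<Sum>v\<in>S. C' v) = m" by auto
  then have "\<exists>v\<in>S. C' v < C v"
    using Suc.prems by (metis not_less not_less_eq_eq order.refl sum_mono)
  then obtain v where v: "v \<in> S" "C' v < C v" by blast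
  have "(\<Sum>w\<in>S. (C'(v := C' v + 1)) w) = (\<Sum>w\<in>S. C' w + (if w = v then 1 else 0))"
    by (intro sum.cong) auto
  also have "\<dots> = Suc m"
    using C' v assms(1) by (simp add: sum.distrib)
  finally show ?case
    using C' v by (intro exI[of _ "C'(v := C' v + 1)"]) auto
qed

section \<open>Well-definedness of rooted pebbling numbers\<close>

locale rooted_digraph = fin_digraph G for G :: "('a, 'b) pre_digraph" +
  fixes r :: 'a
  assumes root_in_verts: "r \<in> verts G"
    and reachable_root: "\<And>v. v \<in> verts G \<Longrightarrow> v \<rightarrow>\<^sup>*\<^bsub>G\<^esub> r"
begin

text \<open>At \<open>r\<close> the threshold \<open>t\<close> suffices, and it doubles with every
  arc going backwards along a walk to \<open>r\<close>. Loops, which this locale allows, leave it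
  unchanged.\<close>

lemma enough_pebbles_at_vertex:
  assumes "v \<in> verts G"
  shows "\<exists>K. \<forall>C. K \<le> C v \<longrightarrow> fold_solvable G r t C"
  using reachable_root[OF assms]
proof (induction rule: converse_reachable_induct)
  case base
  then show ?case unfolding fold_solvable_def by blast
next
  case (step u w)
  then obtain K where K: "\<And>C. K \<le> C w \<Longrightarrow> fold_solvable G r t C" by blast
  show ?case
  proof (cases "u = w")
    case True
    then show ?thesis using K by blast
  next
    case False
    have "fold_solvable G r t C" if "2 * K \<le> C u" for C
    proof -
      have "fold_solvable G r t (C(u := C u - 2 * K, w := C w + K))"
        by (rule K) simp
      then show ?thesis
        using repeated_pebbling_step[OF step.hyps(1) False, of K C] that unfolding fold_solvable_def
        by (meson rtranclp_trans)
    qed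
    then show ?thesis by blast
  qed
qed

text \<open>Pigeonhole: if the size is the sum of the thresholds of all vertices, some vertex
  reaches its own. Hence the \<open>LEAST\<close> in \<open>pebbling_number\<close> is
  attained.\<close>

lemma ex_solvable_size: "\<exists>m. \<forall>C. config_size G C = m \<longrightarrow> fold_solvable G r t C"
proof -
  have "\<forall>v\<in>verts G. \<exists>K. \<forall>C. K \<le> C v \<longrightarrow> fold_solvable G r t C"
    using enough_pebbles_at_vertex by blast
  then obtain K where K: "\<forall>v\<in>verts G. \<forall>C. K v \<le> C v \<longrightarrow> fold_solvable G r t C"
    by (rule bchoice[THEN exE])
  have "fold_solvable G r t C" if "config_size G C = (\<Sum>v\<in>verts G. K v)" for C
  proof (rule ccontr)
    assume "\<not> fold_solvable G r t C"
    then have "C v < K v" if "v \<in> verts G" for v using K that not_le by blast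
    then have "config_size G C < (\<Sum>v\<in>verts G. K v)"
      unfolding config_size_def using root_in_verts by (intro sum_strict_mono) auto
    then show False using that by simp
  qed
  then show ?thesis by blast
qed

lemma pebbling_number_solvable:
  assumes "pebbling_number t G r \<le> config_size G C"
  shows "fold_solvable G r t C"
proof -
  obtain C' where C': "\<forall>v. C' v \<le> C v" "config_size G C' = pebbling_number t G r"
    using ex_subconfig_of_size[OF finite_verts] assms unfolding config_size_def by metis
  moreover have "\<forall>C. config_size G C = pebbling_number t G r \<longrightarrow> fold_solvable G r t C"
    unfolding pebbling_number_def by (rule LeastI_ex[OF ex_solvable_size])
  ultimately have "fold_solvable G r t C'" by blast
  then show ?thesis by (rule fold_solvable_mono) (simp add: C'(1))
qed

lemma pebbling_number_pos:
  assumes "t \<ge> 1"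
  shows "pebbling_number t G r \<ge> 1"
proof (rule ccontr)
  assume "\<not> ?thesis"
  then have "fold_solvable G r t (\<lambda>_. 0)"
    by (intro pebbling_number_solvable) simp
  then obtain D where D: "(pebbling_step G)\<^sup>*\<^sup>* (\<lambda>_. 0) D" "t \<le> D r"
    unfolding fold_solvable_def by blast
  from D(1) have "D = (\<lambda>_. 0)"
    by (rule converse_rtranclpE) (auto simp: pebbling_step_def)
  with D(2) assms show False by simp
qed

text \<open>For \<open>t \<ge> 1\<close> the pebbling number is positive, so its predecessor is
  genuinely smaller and minimality yields an unsolvable configuration of that size.\<close>

lemma ex_unsolvable_config:
  assumes "t \<ge> 1"
  obtains C where "\<not> fold_solvable G r t C" "config_size G C + 1 = pebbling_number t G r"
proof -
  have "pebbling_number t G r - 1 < pebbling_number t G r"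
    using pebbling_number_pos[OF assms] by simp
  then have "\<not> (\<forall>C. config_size G C = pebbling_number t G r - 1 \<longrightarrow> fold_solvable G r t C)"
    by (subst (asm) (2) pebbling_number_def) (rule not_less_Least)
  then show ?thesis using that pebbling_number_pos[OF assms] by force
qed

end

section \<open>Components of symmetric digraphs\<close>

text \<open>The form \<open>arc_mono\<close> is wanted because maximal subgraphs with an
  arc-monotone property are induced.\<close>

lemma arc_mono_connected: "arc_mono Digraph_Component.connected"
  unfolding arc_mono_def
proof (intro allI impI)
  fix H1 H2 :: "('a, 'b) pre_digraph"
  assume "Digraph_Component.connected H1 \<and> subgraph H1 H2 \<and> verts H1 = verts H2"
  then show "Digraph_Component.connected H2"
    by (intro wf_digraph.connected_spanning_imp_connected[of H2 H1])
      (auto simp: spanning_def subgraph_def)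
qed

lemma strongly_connected_imp_connected:
  assumes "wf_digraph G" "strongly_connected G"
  shows "Digraph_Component.connected G"
proof -
  interpret wf_digraph G by fact
  show ?thesis
    using assms(2) by (intro connectedI) (auto simp: strongly_connected_def intro: reachable_mk_symmetricI)
qed

text \<open>Induced subgraphs of a symmetric digraph are symmetric, and there connectivity and
  strong connectivity agree. The identification makes the disjointness of strong components and the
  cover by \<open>scc_of\<close> available.\<close>

lemma (in sym_digraph) components_eq_sccs: "components G = sccs"
proof (intro equalityI subsetI)
  fix H assume "H \<in> components G"
  then have max: "max_subgraph Digraph_Component.connected H"
    by (simp add: components_def)
  then have ind: "induced_subgraph H G"
    by (rule induced_subgraphI_arc_mono[OF _ arc_mono_connected])
  then interpret H: sym_digraph H by (rule induced_graph_imp_graph)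
  have "strongly_connected H"
    using H.symmetric_connected_imp_strongly_connected[OF H.sym_arcs] max
    by (auto dest: max_subgraph_prop)
  then have "induced_subgraph H G \<and> strongly_connected H" using ind by blast
  moreover have False
    if H': "induced_subgraph H' G" "strongly_connected H'" "verts H \<subset> verts H'" for H'
  proof -
    have "Digraph_Component.connected H'"
      using H' by (intro strongly_connected_imp_connected) auto
    moreover have "subgraph H H'"
      using ind H' by (auto simp: induced_subgraph_def subgraph_def compatible_def)
    ultimately show False using max H' by (auto simp: max_subgraph_def induced_subgraph_def)
  qed
  ultimately show "H \<in> sccs" unfolding sccs_def by blast
next
  fix H assume H: "H \<in> sccs"
  then have ind: "induced_subgraph H G" and sc: "strongly_connected H" by auto
  show "H \<in> components G"
    unfolding components_def mem_Collect_eq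
  proof (rule max_subgraphI)
    show "Digraph_Component.connected H"
      using ind sc by (intro strongly_connected_imp_connected) auto
    show "subgraph H G" using ind by auto
  next
    fix H' assume H': "H \<noteq> H'" "subgraph H H'" "subgraph H' G"
    show "\<not> Digraph_Component.connected H'"
    proof
      assume "Digraph_Component.connected H'"
      \<comment> \<open>\<open>H'\<close> itself need not be symmetric; the subgraph induced on its
        vertices is, and it is still connected.\<close>
      then have con: "Digraph_Component.connected (G \<restriction> verts H')"
        using arc_mono_connected subgraph_induce_subgraphI2[OF H'(3)]
        unfolding arc_mono_def by (metis induce_subgraph_verts)
      have ind': "induced_subgraph (G \<restriction> verts H') G"
        using H'(3) by (intro induced_induce) auto
      interpret H': sym_digraph "G \<restriction> verts H'"
        using ind' by (rule induced_graph_imp_graph)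
      have "strongly_connected (G \<restriction> verts H')"
        using H'.symmetric_connected_imp_strongly_connected[OF H'.sym_arcs con] .
      then have "\<not> verts H \<subset> verts (G \<restriction> verts H')"
        using H ind' unfolding sccs_def by blast
      then have "verts H = verts H'" using H'(2) by auto
      \<comment> \<open>\<open>H\<close> is induced, so it already has every arc between its
        vertices and \<open>H'\<close> cannot add one.\<close>
      moreover have "arcs H' \<subseteq> arcs H"
        using ind H' calculation wf_digraph.wellformed[of H']
        by (auto simp: induced_subgraph_def subgraph_def compatible_def)
      ultimately show False
        using H' by (auto simp: subgraph_def compatible_def)
    qed
  qed
qed

section \<open>Splitting a graph at the root\<close>

text \<open>
  The parts are encoded by a colouring \<open>f\<close> of the vertices other than \<open>r\<close>; its value at \<open>r\<close>
  is irrelevant.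
\<close>

locale root_partition = graph G + rooted_digraph G r
  for G :: "('a, 'b) pre_digraph" and r +
  fixes I :: "'i set" and f :: "'a \<Rightarrow> 'i"
  assumes finite_I: "finite I"
    and color_in: "\<And>v. v \<in> verts G \<Longrightarrow> v \<noteq> r \<Longrightarrow> f v \<in> I"
    and cross: "\<And>u v. u \<rightarrow>\<^bsub>G\<^esub> v \<Longrightarrow> u \<noteq> r \<Longrightarrow> v \<noteq> r \<Longrightarrow> f u \<noteq> f v \<Longrightarrow> u \<rightarrow>\<^bsub>G\<^esub> r"
begin

definition part :: "'i \<Rightarrow> ('a, 'b) pre_digraph" where
  "part i = G \<restriction> ({v \<in> verts G. v \<noteq> r \<and> f v = i} \<union> {r})"

lemma verts_part: "verts (part i) = {v \<in> verts G. v \<noteq> r \<and> f v = i} \<union> {r}"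
  by (simp add: part_def)

lemma adj_part: "u \<rightarrow>\<^bsub>part i\<^esub> v \<longleftrightarrow> u \<rightarrow>\<^bsub>G\<^esub> v \<and> (u = r \<or> f u = i) \<and> (v = r \<or> f v = i)"
  unfolding part_def arcs_ends_conv by (auto simp: image_iff)

text \<open>A walk towards \<open>r\<close> that leaves a part before reaching \<open>r\<close> does
  so along an arc to another part; by \<open>cross\<close> the tail of that arc is adjacent to
  \<open>r\<close>, so the walk can be cut short inside the part.\<close>

lemma rooted_part: "rooted_digraph (part i) r"
proof -
  interpret H: wf_digraph "part i"
    unfolding part_def by (rule wellformed_induce_subgraph)
  interpret H: fin_digraph "part i"
    by unfold_locales (auto simp: part_def)
  show ?thesis
  proof
    show "r \<in> verts (part i)" by (simp add: verts_part)
    fix v assume "v \<in> verts (part i)"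
    then have "v = r \<or> f v = i" "v \<rightarrow>\<^sup>*\<^bsub>G\<^esub> r"
      using reachable_root root_in_verts by (auto simp: verts_part)
    from this(2,1) show "v \<rightarrow>\<^sup>*\<^bsub>part i\<^esub> r"
    proof (induction rule: converse_reachable_induct)
      case base
      show ?case by (rule H.reachable_refl) (simp add: verts_part)
    next
      case (step u w)
      show ?case
      proof (cases "w = r \<or> f w = i")
        case True
        then have "u \<rightarrow>\<^bsub>part i\<^esub> w" using step by (simp add: adj_part)
        then show ?thesis using step.IH[OF True] by (rule H.adj_reachable_trans)
      next
        case False
        show ?thesis
        proof (cases "u = r")
          case True
          then show ?thesis by (auto intro: H.reachable_refl simp: verts_part)
        next
          case u: False
          then have "u \<rightarrow>\<^bsub>G\<^esub> r" using cross[of u w] step False by auto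
          then have "u \<rightarrow>\<^bsub>part i\<^esub> r" using step u by (simp add: adj_part)
          then show ?thesis by auto
        qed
      qed
    qed
  qed
qed

sublocale part: rooted_digraph "part i" r for i
  by (rule rooted_part)

section \<open>Pebble counts over the parts and the lower bound\<close>

lemma config_size_root: "config_size G C = C r + (\<Sum>v\<in>verts G - {r}. C v)"
  unfolding config_size_def using root_in_verts by (simp add: sum.remove)

text \<open>The colour classes partition the vertices other than \<open>r\<close>, whereas
  \<open>r\<close> lies in every part and contributes once for each.\<close>

lemma sum_config_size_part:
  "(\<Sum>i\<in>I. config_size (part i) (C i)) = (\<Sum>v\<in>verts G - {r}. C (f v) v) + (\<Sum>i\<in>I. C i r)"
proof -
  have "config_size (part i) (C i) = (\<Sum>v\<in>{v \<in> verts G - {r}. f v = i}. C (f v) v) + C i r" for i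
  proof -
    have "verts (part i) = insert r {v \<in> verts G - {r}. f v = i}"
      by (auto simp: verts_part)
    then show ?thesis
      unfolding config_size_def by (auto intro: sum.cong)
  qed
  moreover have "(\<Sum>i\<in>I. \<Sum>v\<in>{v \<in> verts G - {r}. f v = i}. C (f v) v) = (\<Sum>v\<in>verts G - {r}. C (f v) v)"
    by (intro sum.group) (use color_in finite_I in auto)
  ultimately show ?thesis by (simp add: sum.distrib)
qed

text \<open>
  The invariant is the inequality between pebble counts. A step leaving a part through an edge between two neighbours of the root is
  imitated in its part by a step to the root, and steps out of the root are not imitated at all.
  The right-hand side then never loses more pebbles than \<open>config_size G D\<close>: if a part has fewer than two
  pebbles at the tail \<open>u\<close> of a step, its contribution at \<open>u\<close> drops by at most one.
\<close>

lemma simulation_in_parts: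
  assumes "(pebbling_step G)\<^sup>*\<^sup>* C D"
    and "config_size G C \<le> (\<Sum>v\<in>verts G - {r}. min (C v) (Cs (f v) v)) + (\<Sum>i\<in>I. Cs i r)"
  shows "\<exists>Ds. (\<forall>i. (pebbling_step (part i))\<^sup>*\<^sup>* (Cs i) (Ds i)) \<and>
    config_size G D \<le> (\<Sum>v\<in>verts G - {r}. min (D v) (Ds (f v) v)) + (\<Sum>i\<in>I. Ds i r)"
  using assms(1)
proof (induction rule: rtranclp_induct)
  case base
  then show ?case using assms(2) by (intro exI[of _ Cs]) auto
next
  case (step D D')
  let ?S = "verts G - {r}"
  obtain Ds where Ds: "\<And>i. (pebbling_step (part i))\<^sup>*\<^sup>* (Cs i) (Ds i)"
    and inv: "config_size G D \<le> (\<Sum>v\<in>?S. min (D v) (Ds (f v) v)) + (\<Sum>i\<in>I. Ds i r)"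
    using step.IH by blast
  obtain u v where uv: "u \<rightarrow>\<^bsub>G\<^esub> v" and Du: "2 \<le> D u"
    and D': "D' = D(u := D u - 2, v := D v + 1)"
    using step.hyps(2) unfolding pebbling_step_def by blast
  have neq: "u \<noteq> v" using uv adj_not_same by blast
  have in_verts: "u \<in> verts G" "v \<in> verts G" using uv by (auto intro: adj_in_verts)
  have size: "config_size G D' + 1 = config_size G D"
  proof -
    have "(\<Sum>w\<in>verts G. D' w + (if w = u then 2 else 0)) = (\<Sum>w\<in>verts G. D w + (if w = v then 1 else 0))"
      using Du neq by (intro sum.cong) (auto simp: D')
    then show ?thesis
      using in_verts by (simp add: sum.distrib config_size_def)
  qed
  show ?case
  proof (cases "u \<noteq> r \<and> 2 \<le> Ds (f u) u")
    case False
    have "(\<Sum>w\<in>?S. min (D w) (Ds (f w) w)) \<le> (\<Sum>w\<in>?S. min (D' w) (Ds (f w) w) + (if w = u then 1 else 0))"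
      using False by (intro sum_mono) (auto simp: D')
    also have "\<dots> \<le> (\<Sum>w\<in>?S. min (D' w) (Ds (f w) w)) + 1"
      by (simp add: sum.distrib)
    finally show ?thesis using Ds inv size by (intro exI[of _ Ds]) auto
  next
    case True
    let ?i = "f u"
    have i: "?i \<in> I" using True color_in in_verts by auto
    define w where "w = (if v = r \<or> f v = ?i then v else r)"
    have uw: "u \<rightarrow>\<^bsub>part ?i\<^esub> w"
      using uv True cross[of u v] by (auto simp: w_def adj_part)
    have "u \<noteq> w" using neq True by (auto simp: w_def)
    define E where "E = (Ds ?i)(u := Ds ?i u - 2, w := Ds ?i w + 1)"
    define Es where "Es = Ds(?i := E)"
    have "pebbling_step (part ?i) (Ds ?i) E"
      unfolding pebbling_step_def E_def using uw True by blast
    then have Es: "(pebbling_step (part i))\<^sup>*\<^sup>* (Cs i) (Es i)" for i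
      using Ds by (auto simp: Es_def intro: rtranclp.rtrancl_into_rtrancl)
    \<comment> \<open>The pebble gained at \<open>w\<close> is counted here if \<open>w\<close>
      differs from \<open>r\<close>, and in \<open>on_root\<close> otherwise. Either way the
      right-hand side loses at most one pebble, just as \<open>size\<close> says of the
      left.\<close>
    have off_root: "(\<Sum>x\<in>?S. min (D x) (Ds (f x) x) + (if x = w then 1 else 0))
        \<le> (\<Sum>x\<in>?S. min (D' x) (Es (f x) x) + (if x = u then 2 else 0))"
      using neq \<open>u \<noteq> w\<close> by (intro sum_mono) (auto simp: D' Es_def E_def w_def)
    have on_root: "(\<Sum>i\<in>I. Es i r) = (\<Sum>i\<in>I. Ds i r + (if i = ?i then if w = r then 1 else 0 else 0))"
      using True \<open>u \<noteq> w\<close> by (intro sum.cong) (auto simp: Es_def E_def)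
    have "config_size G D' \<le> (\<Sum>x\<in>?S. min (D' x) (Es (f x) x)) + (\<Sum>i\<in>I. Es i r)"
    proof -
      have "w \<in> verts G" using in_verts root_in_verts by (simp add: w_def)
      then show ?thesis
        using off_root on_root inv size i finite_I in_verts True by (auto simp: sum.distrib split: if_splits)
    qed
    then show ?thesis using Es by blast
  qed
qed

lemma sum_pebbling_number_less:
  assumes "\<And>i. i \<in> I \<Longrightarrow> ts i \<ge> 1" "(\<Sum>i\<in>I. ts i) < t + card I"
  shows "(\<Sum>i\<in>I. pebbling_number (ts i) (part i) r) < pebbling_number t G r + card I"
proof -
  have "\<exists>C. i \<in> I \<longrightarrow> \<not> fold_solvable (part i) r (ts i) C \<and>
      config_size (part i) C + 1 = pebbling_number (ts i) (part i) r" for i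
    using part.ex_unsolvable_config assms(1) by metis
  then obtain Cs where unsolv: "\<And>i. i \<in> I \<Longrightarrow> \<not> fold_solvable (part i) r (ts i) (Cs i)"
    and size: "\<And>i. i \<in> I \<Longrightarrow> config_size (part i) (Cs i) + 1 = pebbling_number (ts i) (part i) r"
    by metis
  \<comment> \<open>The parts share only \<open>r\<close>, so the pebbles their configurations place
    there are pooled.\<close>
  define C where "C v = (if v = r then \<Sum>i\<in>I. Cs i r else Cs (f v) v)" for v
  have size_C: "config_size G C = (\<Sum>v\<in>verts G - {r}. Cs (f v) v) + (\<Sum>i\<in>I. Cs i r)"
    unfolding config_size_root by (auto simp: C_def intro: sum.cong)
  have "\<not> fold_solvable G r t C"
  proof
    assume "fold_solvable G r t C"
    then obtain D where D: "(pebbling_step G)\<^sup>*\<^sup>* C D" "t \<le> D r"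
      unfolding fold_solvable_def by blast
    have "config_size G C \<le> (\<Sum>v\<in>verts G - {r}. min (C v) (Cs (f v) v)) + (\<Sum>i\<in>I. Cs i r)"
      unfolding size_C by (auto simp: C_def intro!: sum_mono)
    then obtain Ds where Ds: "\<And>i. (pebbling_step (part i))\<^sup>*\<^sup>* (Cs i) (Ds i)"
      and inv: "config_size G D \<le> (\<Sum>v\<in>verts G - {r}. min (D v) (Ds (f v) v)) + (\<Sum>i\<in>I. Ds i r)"
      using simulation_in_parts[OF D(1)] by blast
    \<comment> \<open>The off-root terms in \<open>inv\<close> are at most those of
      \<open>D\<close>; cancelling them bounds \<open>D r\<close> by what the parts bring to
      \<open>r\<close>.\<close>
    have "(\<Sum>v\<in>verts G - {r}. min (D v) (Ds (f v) v)) \<le> (\<Sum>v\<in>verts G - {r}. D v)"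
      by (intro sum_mono) simp
    then have "t \<le> (\<Sum>i\<in>I. Ds i r)"
      using inv D(2) unfolding config_size_root by linarith
    moreover have "Ds i r + 1 \<le> ts i" if "i \<in> I" for i
      using unsolv[OF that] Ds[of i] unfolding fold_solvable_def by (auto simp: not_le)
    then have "(\<Sum>i\<in>I. Ds i r + 1) \<le> (\<Sum>i\<in>I. ts i)" by (rule sum_mono)
    ultimately show False using assms(2) by (simp add: sum_Suc)
  qed
  then have "config_size G C < pebbling_number t G r"
    using pebbling_number_solvable not_le by blast
  moreover have "(\<Sum>i\<in>I. pebbling_number (ts i) (part i) r) = (\<Sum>i\<in>I. config_size (part i) (Cs i) + 1)"
    using size by (intro sum.cong) auto
  ultimately show ?thesis by (simp add: sum_Suc size_C sum_config_size_part)
qed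

section \<open>Upper bound by splitting an unsolvable configuration\<close>

lemma unsolvable_config_size_le:
  assumes "\<not> fold_solvable G r t C" "I \<noteq> {}"
  obtains ts where "\<And>i. i \<in> I \<Longrightarrow> ts i \<ge> 1" "(\<Sum>i\<in>I. ts i) + 1 = t + card I"
    "config_size G C + card I \<le> (\<Sum>i\<in>I. pebbling_number (ts i) (part i) r)"
proof -
  obtain k where k: "k \<in> I" using assms(2) by blast
  \<comment> \<open>Only part \<open>k\<close> receives the pebbles of \<open>r\<close>, so that
    none is used twice when the parts are played together.\<close>
  define Cs where
    "Cs i v = (if v \<in> verts G \<and> (v = r \<and> i = k \<or> v \<noteq> r \<and> f v = i) then C v else 0)" for i v
  have sum_Cs: "(\<Sum>i\<in>I. Cs i v) \<le> C v" for v
  proof -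
    have "(\<Sum>i\<in>I. Cs i v) \<le> (\<Sum>i\<in>I. if i = (if v = r then k else f v) then C v else 0)"
      by (intro sum_mono) (auto simp: Cs_def)
    also have "\<dots> \<le> C v" using finite_I by (simp add: sum.delta)
    finally show ?thesis .
  qed
  \<comment> \<open>The maximum exists: 0 is always attainable, and a play in a part is also a play
    in \<open>G\<close>, so \<open>t\<close> bounds the attainable numbers.\<close>
  define s where "s i = (GREATEST m. fold_solvable (part i) r m (Cs i))" for i
  have greatest: "fold_solvable (part i) r (s i) (Cs i) \<and> (\<forall>m. fold_solvable (part i) r m (Cs i) \<longrightarrow> m \<le> s i)"
    if "i \<in> I" for i
  proof -
    have "fold_solvable G r m C" if "fold_solvable (part i) r m (Cs i)" for m
    proof -
      have "fold_solvable G r m (Cs i)"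
        using that pebbling_steps_mono[of "part i" G] unfolding fold_solvable_def
        by (metis adj_part subrelI)
      moreover have "Cs i v \<le> C v" for v by (simp add: Cs_def)
      ultimately show ?thesis by (rule fold_solvable_mono)
    qed
    moreover have "fold_solvable G r m C \<longrightarrow> m \<le> t" for m
      using assms(1) unfolding fold_solvable_def by (meson le_trans nat_le_linear)
    ultimately have bound: "\<And>m. fold_solvable (part i) r m (Cs i) \<Longrightarrow> m \<le> t" by blast
    have "fold_solvable (part i) r 0 (Cs i)"
      unfolding fold_solvable_def by blast
    then show ?thesis
      unfolding s_def
      using GreatestI_nat[of "\<lambda>m. fold_solvable (part i) r m (Cs i)" 0 t] bound
        Greatest_le_nat[of "\<lambda>m. fold_solvable (part i) r m (Cs i)" _ t] by simp
  qed
  have "\<exists>D. i \<in> I \<longrightarrow> (pebbling_step G)\<^sup>*\<^sup>* (Cs i) D \<and> s i \<le> D r" for i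
    using greatest[of i] pebbling_steps_mono[of "part i" G] unfolding fold_solvable_def
    by (metis adj_part subrelI)
  then obtain Ds where Ds: "\<And>i. i \<in> I \<Longrightarrow> (pebbling_step G)\<^sup>*\<^sup>* (Cs i) (Ds i)"
    "\<And>i. i \<in> I \<Longrightarrow> s i \<le> Ds i r"
    by metis
  have "fold_solvable G r (\<Sum>i\<in>I. s i) (\<lambda>v. \<Sum>i\<in>I. Cs i v)"
    unfolding fold_solvable_def using pebbling_steps_sum[OF finite_I Ds(1)] Ds(2)
    by (intro exI[of _ "\<lambda>v. \<Sum>i\<in>I. Ds i v"]) (auto intro: sum_mono)
  then have "fold_solvable G r (\<Sum>i\<in>I. s i) C" using sum_Cs by (rule fold_solvable_mono)
  then have lt: "(\<Sum>i\<in>I. s i) < t"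
    using assms(1) unfolding fold_solvable_def by (meson le_trans not_le)
  \<comment> \<open>By \<open>lt\<close> the subtraction is exact. Giving all the slack to
    \<open>k\<close> fixes the sum of \<open>ts\<close>, and any number above the greatest
    attainable \<open>s i\<close> remains unattainable.\<close>
  define d where "d = t - 1 - (\<Sum>i\<in>I. s i)"
  define ts where "ts i = s i + 1 + (if i = k then d else 0)" for i
  show ?thesis
  proof (rule that[of ts])
    show "ts i \<ge> 1" for i by (simp add: ts_def)
    show "(\<Sum>i\<in>I. ts i) + 1 = t + card I"
      using k finite_I lt by (simp add: ts_def sum_Suc sum.distrib d_def)
    have "config_size (part i) (Cs i) + 1 \<le> pebbling_number (ts i) (part i) r" if "i \<in> I" for i
    proof -
      have "\<not> fold_solvable (part i) r (ts i) (Cs i)"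
        using greatest[OF that] by (fastforce simp: ts_def)
      then show ?thesis
        using part.pebbling_number_solvable[of "ts i" i "Cs i"] by linarith
    qed
    then have "(\<Sum>i\<in>I. config_size (part i) (Cs i) + 1) \<le> (\<Sum>i\<in>I. pebbling_number (ts i) (part i) r)"
      by (rule sum_mono)
    moreover have "(\<Sum>i\<in>I. config_size (part i) (Cs i)) = config_size G C"
    proof -
      have "(\<Sum>i\<in>I. Cs i r) = C r"
        using k finite_I root_in_verts by (simp add: Cs_def sum.delta)
      moreover have "(\<Sum>v\<in>verts G - {r}. Cs (f v) v) = (\<Sum>v\<in>verts G - {r}. C v)"
        by (intro sum.cong) (auto simp: Cs_def)
      ultimately show ?thesis unfolding sum_config_size_part config_size_root by simp
    qed
    ultimately show "config_size G C + card I \<le> (\<Sum>i\<in>I. pebbling_number (ts i) (part i) r)"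
      by (simp add: sum_Suc)
  qed
qed

text \<open>The lower bound controls every member of the set, and a largest unsolvable configuration
  supplies a member at least as large as the pebbling number. Integers keep the subtraction of
  \<open>card I\<close> exact.\<close>

lemma pebbling_number_eq_Max:
  assumes "t \<ge> 1" "I \<noteq> {}"
  shows "int (pebbling_number t G r) =
    Max {(\<Sum>i\<in>I. int (pebbling_number (ts i) (part i) r)) - int (card I) + 1 | ts.
           (\<forall>i\<in>I. ts i \<ge> 1) \<and> (\<Sum>i\<in>I. ts i) = t + card I - 1}"
    (is "_ = Max ?M")
proof (rule Max_eqI[symmetric])
  have card: "card I \<ge> 1" using assms(2) finite_I by (simp add: Suc_leI card_gt_0_iff)
  have upper: "x \<le> int (pebbling_number t G r)" if "x \<in> ?M" for x
  proof -
    obtain ts where ts: "\<forall>i\<in>I. ts i \<ge> 1" "(\<Sum>i\<in>I. ts i) = t + card I - 1"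
      and x: "x = (\<Sum>i\<in>I. int (pebbling_number (ts i) (part i) r)) - int (card I) + 1"
      using \<open>x \<in> ?M\<close> by blast
    have "(\<Sum>i\<in>I. pebbling_number (ts i) (part i) r) < pebbling_number t G r + card I"
      using ts card by (intro sum_pebbling_number_less) auto
    then show ?thesis unfolding x of_nat_sum[symmetric] by linarith
  qed
  \<comment> \<open>There may be infinitely many functions \<open>ts\<close>; finiteness comes from
    the values lying in a bounded interval of integers.\<close>
  have "- int (card I) \<le> x" if "x \<in> ?M" for x
    using \<open>x \<in> ?M\<close> by (auto simp flip: of_nat_sum)
  then have "?M \<subseteq> {- int (card I)..int (pebbling_number t G r)}"
    using upper by (intro subsetI) (simp only: atLeastAtMost_iff)
  then show "finite ?M" by (rule finite_subset) simp
  show "x \<le> int (pebbling_number t G r)" if "x \<in> ?M" for x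
    using that by (rule upper)
  obtain C where C: "\<not> fold_solvable G r t C" "config_size G C + 1 = pebbling_number t G r"
    using ex_unsolvable_config[OF assms(1)] .
  obtain ts where ts: "\<And>i. i \<in> I \<Longrightarrow> ts i \<ge> 1" "(\<Sum>i\<in>I. ts i) + 1 = t + card I"
    "config_size G C + card I \<le> (\<Sum>i\<in>I. pebbling_number (ts i) (part i) r)"
    using unsolvable_config_size_le[OF C(1) assms(2)] by metis
  have in_M: "(\<Sum>i\<in>I. int (pebbling_number (ts i) (part i) r)) - int (card I) + 1 \<in> ?M"
    using ts by (intro CollectI exI[of _ ts]) auto
  moreover have "(\<Sum>i\<in>I. int (pebbling_number (ts i) (part i) r)) - int (card I) + 1
      = int (pebbling_number t G r)"
    using upper[OF in_M] C(2) ts(3) unfolding of_nat_sum[symmetric] by linarith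
  ultimately show "int (pebbling_number t G r) \<in> ?M" by metis
qed

end

section \<open>Application to the components left after deleting the root and
  \<open>E\<^sub>r\<close>\<close>

text \<open>As \<open>F\<close> contains unordered pairs, mutually reverse arcs are deleted or kept
  together.\<close>

lemma sym_digraph_del_edges:
  assumes "sym_digraph G"
  shows "sym_digraph (del_edges G F)"
proof -
  interpret sym_digraph G by fact
  show ?thesis
  proof
    show "symmetric (del_edges G F)"
      using sym_arcs unfolding symmetric_conv del_edges_def
      by (fastforce simp: insert_commute)
  qed (auto simp: del_edges_def)
qed

lemma sym_digraph_del_vert:
  assumes "sym_digraph G"
  shows "sym_digraph (pre_digraph.del_vert G r)"
proof -
  interpret sym_digraph G by fact
  interpret D: wf_digraph "del_vert r" by (rule wf_digraph_del_vert)
  show ?thesis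
  proof
    show "symmetric (del_vert r)"
      using sym_arcs unfolding symmetric_conv del_vert_simps by simp metis
  qed
qed

theorem theorem17:
  fixes G :: "('a, 'b) pre_digraph"
    and r :: 'a
    and t j :: nat
    and E\<^sub>r :: "'a set set"
    and Gs :: "nat \<Rightarrow> ('a, 'b) pre_digraph"
  assumes "graph G"
    and "Digraph_Component.connected G"
    and "r \<in> verts G"
    and "t \<ge> 1"
    and "E\<^sub>r \<subseteq> edges G"
    and "\<forall>e\<in>E\<^sub>r. \<forall>v\<in>e. r \<rightarrow>\<^bsub>G\<^esub> v"
    and "bij_betw Gs {1..j} (components (del_edges (pre_digraph.del_vert G r) E\<^sub>r))"
    and "j > 1"
  shows "int (pebbling_number t G r) =
    Max {(\<Sum>i=1..j. int (pebbling_number (ts i) (G \<restriction> (verts (Gs i) \<union> {r})) r)) - int j + 1 | ts :: nat \<Rightarrow> nat.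
           (\<forall>i\<in>{1..j}. ts i \<ge> 1) \<and> (\<Sum>i=1..j. ts i) = t + j - 1}"
proof -
  interpret graph G by fact
  define K where "K = del_edges (del_vert r) E\<^sub>r"
  interpret K: sym_digraph K
    unfolding K_def by (intro sym_digraph_del_edges sym_digraph_del_vert sym_digraph_axioms)
  have verts_K: "verts K = verts G - {r}"
    by (simp add: K_def del_edges_def verts_del_vert)
  have adj_K: "u \<rightarrow>\<^bsub>K\<^esub> v \<or> {u, v} \<in> E\<^sub>r" if "u \<rightarrow>\<^bsub>G\<^esub> v" "u \<noteq> r" "v \<noteq> r" for u v
    using that by (auto simp: K_def del_edges_def del_vert_simps arcs_ends_conv)
  have bij: "bij_betw Gs {1..j} K.sccs"
    using assms(7) unfolding K_def[symmetric] K.components_eq_sccs .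
  have "\<exists>i\<in>{1..j}. v \<in> verts (Gs i)" if v: "v \<in> verts K" for v
  proof -
    have "K.scc_of v \<in> verts ` K.sccs"
      using K.scc_of_in_sccs_verts[OF v] by (simp add: K.sccs_verts_conv)
    then obtain H where "H \<in> K.sccs" "v \<in> verts H"
      using K.in_scc_of_self[OF v] by (metis imageE)
    then show ?thesis
      using bij_betw_imp_surj_on[OF bij] by (metis imageE)
  qed
  then obtain f where f: "\<And>v. v \<in> verts K \<Longrightarrow> f v \<in> {1..j}" "\<And>v. v \<in> verts K \<Longrightarrow> v \<in> verts (Gs (f v))"
    by metis
  \<comment> \<open>Injectivity of \<open>Gs\<close> and disjointness of strong components will make
    the component index \<open>f v\<close> unique.\<close>
  have scc: "verts (Gs i) \<in> K.sccs_verts" if "i \<in> {1..j}" for i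
    using bij that by (auto simp: bij_betw_def K.sccs_verts_conv)
  have f_eq: "f v = i" if "i \<in> {1..j}" "v \<in> verts (Gs i)" for i v
  proof (rule ccontr)
    assume neq: "f v \<noteq> i"
    have v: "v \<in> verts K" using K.sccs_verts_subsets[OF scc] that by blast
    have "Gs (f v) \<noteq> Gs i"
      using bij f(1)[OF v] that(1) neq unfolding bij_betw_def by (metis inj_onD)
    then have "verts (Gs (f v)) \<inter> verts (Gs i) = {}"
      using bij f(1)[OF v] that(1) unfolding bij_betw_def by (intro K.scc_disj) blast+
    then show False using f(2)[OF v] that(2) by blast
  qed
  interpret root_partition G r "{1..j}" f
  proof
    show "r \<in> verts G" by fact
    show "v \<rightarrow>\<^sup>*\<^bsub>G\<^esub> r" if "v \<in> verts G" for v
      using symmetric_connected_imp_strongly_connected[OF sym_arcs assms(2)] that assms(3)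
      by (auto simp: strongly_connected_def)
    show "finite {1..j}" by simp
    show "f v \<in> {1..j}" if "v \<in> verts G" "v \<noteq> r" for v
      using f(1) that by (simp add: verts_K)
    fix u v assume uv: "u \<rightarrow>\<^bsub>G\<^esub> v" "u \<noteq> r" "v \<noteq> r" "f u \<noteq> f v"
    then have in_K: "u \<in> verts K" "v \<in> verts K"
      by (auto simp: verts_K adj_in_verts)
    have "\<not> u \<rightarrow>\<^bsub>K\<^esub> v"
    proof
      assume "u \<rightarrow>\<^bsub>K\<^esub> v"
      then have "u \<rightarrow>\<^sup>*\<^bsub>K\<^esub> v" "v \<rightarrow>\<^sup>*\<^bsub>K\<^esub> u"
        by (auto intro: K.symmetric_reachable')
      then have "v \<in> verts (Gs (f u))"
        using scc[OF f(1)[OF in_K(1)]] f(2)[OF in_K(1)] unfolding K.in_sccs_verts_conv_reachable by blast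
      then show False using f_eq[OF f(1)[OF in_K(1)]] uv(4) by simp
    qed
    \<comment> \<open>An edge of \<open>G - r\<close> between different components is missing from
      \<open>K\<close>, hence was deleted and lies in \<open>E\<^sub>r\<close>, whose edges join
      neighbours of \<open>r\<close>.\<close>
    then have "r \<rightarrow>\<^bsub>G\<^esub> u" using adj_K[OF uv(1-3)] assms(6) by blast
    then show "u \<rightarrow>\<^bsub>G\<^esub> r" by (rule graph_symmetric)
  qed
  have "part i = G \<restriction> (verts (Gs i) \<union> {r})" if "i \<in> {1..j}" for i
  proof -
    have "{v \<in> verts G. v \<noteq> r \<and> f v = i} = verts (Gs i)"
      using f(2) f_eq[OF that] K.sccs_verts_subsets[OF scc[OF that]] verts_K by auto
    then show ?thesis by (simp add: part_def)
  qed
  then have "(\<Sum>i=1..j. int (pebbling_number (ts i) (part i) r)) =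
      (\<Sum>i=1..j. int (pebbling_number (ts i) (G \<restriction> (verts (Gs i) \<union> {r})) r))" for ts
    by (intro sum.cong) auto
  then show ?thesis
    using pebbling_number_eq_Max[OF assms(4)] assms(8) by simp
qed

end
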